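(* Let $T$ be the set of roots (in $\mathbb{C}$) of $\dfrac{H(y)}{(y-1)(y+1)}$. Then the spectrum of the $(n+1)\times(n+1)$ matrix $A$ is $\sigma(A)=\{\, y+y^{-1} : y\in T\,\}$.
   Context: Let $n\ge 1$ be an integer and $b_0,b_1,c_{-1},c_0\in\mathbb{C}$. $A=A_{n+1}$ is the complex tridiagonal $(n+1)\times(n+1)$ matrix with rows and columns indexed by $0,\dots,n$, whose nonzero entries are as follows: row $0$ has $A_{0,0}=-b_0$, $A_{0,1}=1-b_1$; for $1\le k\le n-1$, $A_{k,k-1}=A_{k,k+1}=1$ (and zero diagonal); row $n$ has $A_{n,n-1}=1-c_{-1}$, $A_{n,n}=-c_0$; all other entries are $0$. The polynomial associated to $A$ is $$H(z)=z^{2n}(b_1+b_0z+z^2)(c_{-1}+c_0z+z^2)-(b_1z^2+b_0z+1)(c_{-1}z^2+c_0z+1).$$ Since $H(1)=H(-1)=0$, the quotient $H(y)/((y-1)(y+1))$ is a polynomial. *)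

theory Defs
  imports "Jordan_Normal_Form.Spectral_Radius"
begin

text \<open>Throughout, the parameter \<open>cm1\<close> stands for the coefficient $c_{-1}$.\<close>

definition tridiag_mat ::
  "nat \<Rightarrow> complex \<Rightarrow> complex \<Rightarrow> complex \<Rightarrow> complex \<Rightarrow> complex mat" where
  "tridiag_mat n b0 b1 cm1 c0 =
     mat (n + 1) (n + 1) (\<lambda>(i, j).
       if i = 0 then (if j = 0 then - b0 else if j = 1 then 1 - b1 else 0)
       else if i = n then (if j + 1 = n then 1 - cm1 else if j = n then - c0 else 0)
       else (if j + 1 = i \<or> j = i + 1 then 1 else 0))"

text \<open>Coefficient lists are in ascending order, so \<open>[:b1, b0, 1:]\<close> is $b_1 + b_0 z + z^2$.\<close>

definition assoc_poly ::
  "nat \<Rightarrow> complex \<Rightarrow> complex \<Rightarrow> complex \<Rightarrow> complex \<Rightarrow> complex poly" where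
  "assoc_poly n b0 b1 cm1 c0 =
     monom 1 (2 * n) * [:b1, b0, 1:] * [:cm1, c0, 1:] - [:1, b0, b1:] * [:1, c0, cm1:]"

definition reduced_poly ::
  "nat \<Rightarrow> complex \<Rightarrow> complex \<Rightarrow> complex \<Rightarrow> complex \<Rightarrow> complex poly" where
  "reduced_poly n b0 b1 cm1 c0 = assoc_poly n b0 b1 cm1 c0 div ([:- 1, 1:] * [:1, 1:])"

text \<open>The polynomial division in \<open>reduced_poly\<close> is exact.\<close>

lemma reduced_poly_mult:
  "reduced_poly n b0 b1 cm1 c0 * ([:- 1, 1:] * [:1, 1:]) = assoc_poly n b0 b1 cm1 c0"
proof -
  let ?H = "assoc_poly n b0 b1 cm1 c0"
  have "poly ?H 1 = 0"
    by (simp add: assoc_poly_def poly_monom algebra_simps)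
  then obtain q where q: "?H = [:- 1, 1:] * q"
    unfolding poly_eq_0_iff_dvd by (auto elim: dvdE)
  have "poly ?H (- 1) = 0"
    by (simp add: assoc_poly_def poly_monom algebra_simps)
  with q have "poly q (- 1) = 0"
    by simp
  then have "[:1, 1:] dvd q"
    unfolding poly_eq_0_iff_dvd by simp
  then have "[:- 1, 1:] * [:1, 1:] dvd ?H"
    unfolding q by (rule mult_dvd_mono[OF dvd_refl])
  then show ?thesis
    unfolding reduced_poly_def by (rule dvd_div_mult_self)
qed

text \<open>
  In particular, $0$ is not a root, so the convention \<open>inverse 0 = 0\<close> is never used
  when $y^{-1}$ is formed for a root $y$.
\<close>

lemma reduced_poly_0_nonzero:
  assumes "n \<ge> 1"
  shows "poly (reduced_poly n b0 b1 cm1 c0) 0 \<noteq> 0"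
proof
  assume "poly (reduced_poly n b0 b1 cm1 c0) 0 = 0"
  then have "poly (assoc_poly n b0 b1 cm1 c0) 0 = 0"
    by (simp flip: reduced_poly_mult)
  with assms show False
    by (simp add: assoc_poly_def poly_monom power_0_left)
qed

end

theory Submission
  imports Defs
begin

text \<open>
  For an eigenvector \<open>v\<close> of the matrix with eigenvalue \<open>x\<close>, the inner rows say that the entries
  satisfy $v_{k+1} = x v_k - v_{k-1}$.  Hence $v$ lies in the two-dimensional space of sequences
  $a s_{k+1} + b s_k$, where $s$ is the solution of the recurrence starting with $0, 1$; here
  $a = v_0$ and $b = -v_{-1}$ for the continuation of the recurrence to the index $-1$.
  This parametrisation involves no division, so it is valid for all values of the parameters (also
  when the corner entry $1 - b_1$ vanishes) and for all $x$ (also for $x = \pm 2$, where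
  $y^k$ and $y^{-k}$ become linearly dependent).  The first and the last row become two linear
  equations in $(a, b)$, so \<open>x\<close> is an eigenvalue iff the determinant $D(x)$ of this
  two-by-two system is zero (\<open>eigenvalue_tridiag_iff\<close>).

  Substitute $x = y + y^{-1}$ with $y \neq 0$.  Then $y^k s_k = y (1 + y^2 + \dots + y^{2(k-1)})$,
  so $y^{n+1} D(y + y^{-1})$ is a polynomial in $y$, and summing the geometric series shows that
  its product with $y^2 - 1$ is $H(y)$.  Cancelling $y^2 - 1$ in the polynomial ring, rather than
  pointwise, identifies it with the quotient of $H$ at the points $y = \pm 1$ as well
  (\<open>poly_reduced_poly_eq\<close>).  As every complex number has the form $y + y^{-1}$, the
  theorem follows.
\<close>

section \<open>The three-term recurrence\<close>

text \<open>These are the Chebyshev polynomials of the second kind: $s_k = U_{k-1}(x/2)$.\<close>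

fun rec_sol :: "complex \<Rightarrow> nat \<Rightarrow> complex" where
  "rec_sol x 0 = 0"
| "rec_sol x (Suc 0) = 1"
| "rec_sol x (Suc (Suc k)) = x * rec_sol x (Suc k) - rec_sol x k"

lemma recurrence_unique:
  assumes "\<And>k. 1 \<le> k \<Longrightarrow> k < n \<Longrightarrow> x * u k = u (k - 1) + u (k + 1)" and "k \<le> n"
  shows "u k = u 0 * rec_sol x (Suc k) + (u 1 - x * u 0) * rec_sol x k"
  using assms(2)
proof (induction k rule: less_induct)
  case (less k)
  consider "k = 0" | "k = 1" | j where "k = Suc (Suc j)"
    by (metis One_nat_def not0_implies_Suc)
  then show ?case
  proof cases
    case 3
    have "u k = x * u (Suc j) - u j"
      using assms(1)[of "Suc j"] less.prems 3 by (simp add: algebra_simps)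
    then show ?thesis
      using less.IH[of j] less.IH[of "Suc j"] less.prems 3 by (simp add: algebra_simps)
  qed (simp_all add: algebra_simps)
qed

lemma rec_sol_geometric:
  assumes "y \<noteq> 0"
  shows "y ^ k * rec_sol (y + inverse y) k = y * (\<Sum>i<k. y ^ (2 * i))"
proof (induction k rule: induct_nat_012)
  case (ge2 k)
  have "y ^ Suc (Suc k) * rec_sol (y + inverse y) (Suc (Suc k))
      = (y\<^sup>2 + 1) * (y ^ Suc k * rec_sol (y + inverse y) (Suc k))
        - y\<^sup>2 * (y ^ k * rec_sol (y + inverse y) k)"
    using assms by (simp add: field_simps power2_eq_square)
  also have "\<dots> = y * (\<Sum>i<Suc (Suc k). y ^ (2 * i))"
    unfolding ge2 by (simp add: algebra_simps power2_eq_square power_add)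
  finally show ?case .
qed simp_all

section \<open>The eigenvalue equation\<close>

lemma tridiag_mult_eq_smult_iff:
  assumes n: "n \<ge> 1" and v: "v \<in> carrier_vec (n + 1)"
  shows "tridiag_mat n b0 b1 cm1 c0 *\<^sub>v v = x \<cdot>\<^sub>v v \<longleftrightarrow>
    x * v $ 0 = - b0 * v $ 0 + (1 - b1) * v $ 1 \<and>
    (\<forall>k. 1 \<le> k \<longrightarrow> k < n \<longrightarrow> x * v $ k = v $ (k - 1) + v $ (k + 1)) \<and>
    x * v $ n = (1 - cm1) * v $ (n - 1) - c0 * v $ n"
proof -
  let ?A = "tridiag_mat n b0 b1 cm1 c0"
  have sum_two: "(\<Sum>j = 0..<n + 1. f j) = f p + f q"
    if "p \<noteq> q" "p \<le> n" "q \<le> n" "\<And>j. j \<noteq> p \<Longrightarrow> j \<noteq> q \<Longrightarrow> f j = 0"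
    for f :: "nat \<Rightarrow> complex" and p q
  proof -
    have "(\<Sum>j = 0..<n + 1. f j) = sum f {p, q}"
      using that by (intro sum.mono_neutral_right) auto
    then show ?thesis using that by simp
  qed
  have entry: "(?A *\<^sub>v v) $ i = (\<Sum>j = 0..<n + 1. (
       if i = 0 then (if j = 0 then - b0 else if j = 1 then 1 - b1 else 0)
       else if i = n then (if j + 1 = n then 1 - cm1 else if j = n then - c0 else 0)
       else (if j + 1 = i \<or> j = i + 1 then 1 else 0)) * v $ j)" if "i \<le> n" for i
    using that v by (simp add: tridiag_mat_def scalar_prod_def)
  have row_0: "(?A *\<^sub>v v) $ 0 = - b0 * v $ 0 + (1 - b1) * v $ 1"
    using n by (subst entry, simp, subst sum_two[of 0 1]) auto
  have row_n: "(?A *\<^sub>v v) $ n = (1 - cm1) * v $ (n - 1) - c0 * v $ n"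
    using n by (subst entry, simp, subst sum_two[of "n - 1" n]) auto
  have row_k: "(?A *\<^sub>v v) $ k = v $ (k - 1) + v $ (k + 1)" if "1 \<le> k" "k < n" for k
    using that by (subst entry, simp, subst sum_two[of "k - 1" "k + 1"]) auto
  have dims: "dim_vec (?A *\<^sub>v v) = n + 1" "dim_vec v = n + 1"
    using v by (simp_all add: tridiag_mat_def)
  have "?A *\<^sub>v v = x \<cdot>\<^sub>v v \<longleftrightarrow> (\<forall>i\<le>n. x * v $ i = (?A *\<^sub>v v) $ i)"
    using dims by (auto simp: vec_eq_iff less_Suc_eq_le)
  also have "\<dots> \<longleftrightarrow> x * v $ 0 = (?A *\<^sub>v v) $ 0 \<and>
      (\<forall>k. 1 \<le> k \<longrightarrow> k < n \<longrightarrow> x * v $ k = (?A *\<^sub>v v) $ k) \<and> x * v $ n = (?A *\<^sub>v v) $ n"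
    by (metis One_nat_def Suc_leI le0 le_neq_implies_less less_imp_le neq0_conv order_refl)
  finally show ?thesis
    by (simp add: row_0 row_n row_k cong: conj_cong)
qed

lemma two_by_two_kernel_iff:
  fixes p q r t :: "'a :: field"
  shows "(\<exists>a b. (a \<noteq> 0 \<or> b \<noteq> 0) \<and> p * a + q * b = 0 \<and> r * a + t * b = 0) \<longleftrightarrow> p * t - q * r = 0"
proof
  assume "\<exists>a b. (a \<noteq> 0 \<or> b \<noteq> 0) \<and> p * a + q * b = 0 \<and> r * a + t * b = 0"
  then obtain a b where ab: "a \<noteq> 0 \<or> b \<noteq> 0" "p * a + q * b = 0" "r * a + t * b = 0"
    by blast
  have "(p * t - q * r) * a = t * (p * a + q * b) - q * (r * a + t * b)"
    and "(p * t - q * r) * b = p * (r * a + t * b) - r * (p * a + q * b)"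
    by (simp_all add: algebra_simps)
  with ab show "p * t - q * r = 0" by auto
next
  assume det: "p * t - q * r = 0"
  consider "p \<noteq> 0 \<or> q \<noteq> 0" | "p = 0" "q = 0" "r \<noteq> 0 \<or> t \<noteq> 0" | "p = 0" "q = 0" "r = 0" "t = 0"
    by blast
  then show "\<exists>a b. (a \<noteq> 0 \<or> b \<noteq> 0) \<and> p * a + q * b = 0 \<and> r * a + t * b = 0"
  proof cases
    case 1
    then show ?thesis using det
      by (intro exI[of _ q] exI[of _ "- p"]) (auto simp: algebra_simps)
  next
    case 2
    then show ?thesis by (intro exI[of _ t] exI[of _ "- r"]) (auto simp: algebra_simps)
  next
    case 3
    then show ?thesis by (intro exI[of _ 1]) auto
  qed
qed

text \<open>
  The value of the last boundary condition $v_{n+1} + c_0 v_n + c_{-1} v_{n-1}$ on the basis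
  solution $v_k = s_k$; on the shifted solution $v_k = s_{k+1}$ it is the same with \<open>Suc n\<close>.
\<close>

definition end_form :: "complex \<Rightarrow> complex \<Rightarrow> complex \<Rightarrow> nat \<Rightarrow> complex" where
  "end_form cm1 c0 x n =
     rec_sol x (n + 1) + c0 * rec_sol x n + cm1 * rec_sol x (n - 1)"

text \<open>
  With $v_k = a s_{k+1} + b s_k$ the outer rows read $v_{-1} + b_0 v_0 + b_1 v_1 = 0$ and
  $v_{n+1} + c_0 v_n + c_{-1} v_{n-1} = 0$, where $v_{-1} = -b$, $v_0 = a$ and
  $v_1 = x a + b$.  As \<open>n \<ge> 1\<close>, both $v_0$ and $v_1$ are entries of the vector, so it
  is nonzero iff $(a, b)$ is.
\<close>

lemma eigenvalue_tridiag_iff: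
  assumes n: "n \<ge> 1"
  shows "eigenvalue (tridiag_mat n b0 b1 cm1 c0) x \<longleftrightarrow>
    (b0 + b1 * x) * end_form cm1 c0 x n + (1 - b1) * end_form cm1 c0 x (Suc n) = 0"
proof -
  let ?A = "tridiag_mat n b0 b1 cm1 c0" and ?s = "rec_sol x"
  let ?p = "b0 + b1 * x" and ?q = "b1 - 1"
  let ?r = "end_form cm1 c0 x (Suc n)" and ?t = "end_form cm1 c0 x n"
  have s_n: "?s (Suc n) = x * ?s n - ?s (n - 1)"
    using n by (cases n) auto
  have last: "x * v = (1 - cm1) * w - c0 * v \<longleftrightarrow> ?r * a + ?t * b = 0"
    if "v = a * ?s (Suc n) + b * ?s n" "w = a * ?s n + b * ?s (n - 1)" for v w a b
  proof -
    have "x * v - ((1 - cm1) * w - c0 * v) = ?r * a + ?t * b"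
      unfolding that end_form_def by (simp add: s_n algebra_simps)
    then show ?thesis by (metis eq_iff_diff_eq_0)
  qed
  have first: "x * a = - b0 * a + (1 - b1) * (x * a + b) \<longleftrightarrow> ?p * a + ?q * b = 0" for a b
  proof -
    have "x * a - (- b0 * a + (1 - b1) * (x * a + b)) = ?p * a + ?q * b"
      by (simp add: algebra_simps)
    then show ?thesis by (metis eq_iff_diff_eq_0)
  qed
  have "eigenvalue ?A x \<longleftrightarrow>
      (\<exists>a b. (a \<noteq> 0 \<or> b \<noteq> 0) \<and> ?p * a + ?q * b = 0 \<and> ?r * a + ?t * b = 0)"
  proof
    assume "eigenvalue ?A x"
    then obtain v where v: "v \<in> carrier_vec (n + 1)" "v \<noteq> 0\<^sub>v (n + 1)" "?A *\<^sub>v v = x \<cdot>\<^sub>v v"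
      unfolding eigenvalue_def eigenvector_def by (auto simp: tridiag_mat_def)
    define a where "a = v $ 0"
    define b where "b = v $ 1 - x * v $ 0"
    note rows = v(3)[unfolded tridiag_mult_eq_smult_iff[OF n v(1)]]
    have sol: "v $ k = a * ?s (Suc k) + b * ?s k" if "k \<le> n" for k
      unfolding a_def b_def using rows that
      by (intro recurrence_unique[where u = "\<lambda>k. v $ k"]) auto
    have "a \<noteq> 0 \<or> b \<noteq> 0"
    proof (rule ccontr)
      assume "\<not> (a \<noteq> 0 \<or> b \<noteq> 0)"
      then have "v = 0\<^sub>v (n + 1)"
        using v(1) sol by (intro eq_vecI) auto
      with v(2) show False by simp
    qed
    moreover have "?p * a + ?q * b = 0"
      using rows by (subst first[symmetric]) (simp add: a_def b_def)
    moreover have "?r * a + ?t * b = 0"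
      using rows sol[of n] sol[of "n - 1"] n by (subst last[symmetric]) auto
    ultimately show "\<exists>a b. (a \<noteq> 0 \<or> b \<noteq> 0) \<and> ?p * a + ?q * b = 0 \<and> ?r * a + ?t * b = 0"
      by blast
  next
    assume "\<exists>a b. (a \<noteq> 0 \<or> b \<noteq> 0) \<and> ?p * a + ?q * b = 0 \<and> ?r * a + ?t * b = 0"
    then obtain a b where ab: "a \<noteq> 0 \<or> b \<noteq> 0" "?p * a + ?q * b = 0" "?r * a + ?t * b = 0"
      by blast
    define v where "v = vec (n + 1) (\<lambda>k. a * ?s (Suc k) + b * ?s k)"
    have sol: "v $ k = a * ?s (Suc k) + b * ?s k" if "k \<le> n" for k
      using that by (simp add: v_def)
    have v: "v \<in> carrier_vec (n + 1)" by (simp add: v_def)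
    have v01: "v $ 0 = a" "v $ 1 = x * a + b"
      using n by (simp_all add: sol)
    have "v \<noteq> 0\<^sub>v (n + 1)"
      using v01 ab(1) n by auto
    moreover have "?A *\<^sub>v v = x \<cdot>\<^sub>v v"
      unfolding tridiag_mult_eq_smult_iff[OF n v]
    proof (intro conjI allI impI)
      show "x * v $ 0 = - b0 * v $ 0 + (1 - b1) * v $ 1"
        unfolding v01 first by (rule ab(2))
      show "x * v $ n = (1 - cm1) * v $ (n - 1) - c0 * v $ n"
        using sol[of n] sol[of "n - 1"] n ab(3) by (subst last) auto
      show "x * v $ k = v $ (k - 1) + v $ (k + 1)" if "1 \<le> k" "k < n" for k
      proof -
        obtain j where "k = Suc j" using \<open>1 \<le> k\<close> by (cases k) auto
        then show ?thesis using that by (simp add: sol algebra_simps)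
      qed
    qed
    ultimately show "eigenvalue ?A x"
      unfolding eigenvalue_def eigenvector_def using v by (auto simp: tridiag_mat_def)
  qed
  also have "\<dots> \<longleftrightarrow> ?p * ?t - ?q * ?r = 0"
    by (rule two_by_two_kernel_iff)
  finally show ?thesis by (simp add: algebra_simps)
qed

section \<open>The associated polynomial\<close>

text \<open>
  Clearing denominators in the two-by-two determinant at $x = y + y^{-1}$ gives a combination
  \<open>R\<close> of geometric sums in $y^2$.  Multiplication by $y^2 - 1$ turns each sum over
  \<open>i < k\<close> into $y^{2k} - 1$, and what remains to be compared with $H(y)$ is an identity
  polynomial in $y$ and $y^{2(n-1)}$.
\<close>

lemma poly_reduced_poly_eq:
  assumes n: "n \<ge> 1" and y: "y \<noteq> 0"
  defines "x \<equiv> y + inverse y"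
  shows "poly (reduced_poly n b0 b1 cm1 c0) y =
    y ^ (n + 1) *
      ((b0 + b1 * x) * end_form cm1 c0 x n + (1 - b1) * end_form cm1 c0 x (Suc n))"
proof -
  define g :: "nat \<Rightarrow> complex poly" where "g k = (\<Sum>i<k. monom 1 (2 * i))" for k
  define R where "R = [:b1, b0, b1:] * (g (n + 1) + [:0, c0:] * g n + [:0, 0, cm1:] * g (n - 1))
    + [:1 - b1:] * (g (n + 2) + [:0, c0:] * g (n + 1) + [:0, 0, cm1:] * g n)"
  have poly_g: "poly (g k) z = (\<Sum>i<k. z ^ (2 * i))" for k z
    by (simp add: g_def poly_sum poly_monom)
  have g_mult: "poly (g k) z * (z\<^sup>2 - 1) = (z\<^sup>2) ^ k - 1" for k z
    by (induction k) (simp_all add: poly_g algebra_simps flip: power_mult)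
  have R: "R * ([:- 1, 1:] * [:1, 1:]) = assoc_poly n b0 b1 cm1 c0"
  proof (rule poly_eq_poly_eq_iff[THEN iffD1], rule ext)
    fix z :: complex
    obtain m where m: "n = Suc m" using n by (cases n) auto
    have "poly (R * ([:- 1, 1:] * [:1, 1:])) z =
        (b1 + b0 * z + b1 * z\<^sup>2) *
          (poly (g (n + 1)) z * (z\<^sup>2 - 1) + c0 * z * (poly (g n) z * (z\<^sup>2 - 1))
            + cm1 * z\<^sup>2 * (poly (g (n - 1)) z * (z\<^sup>2 - 1)))
        + (1 - b1) * (poly (g (n + 2)) z * (z\<^sup>2 - 1) + c0 * z * (poly (g (n + 1)) z * (z\<^sup>2 - 1))
            + cm1 * z\<^sup>2 * (poly (g n) z * (z\<^sup>2 - 1)))"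
      unfolding R_def by (simp add: power2_eq_square algebra_simps)
    also have "\<dots> = poly (assoc_poly n b0 b1 cm1 c0) z"
      unfolding g_mult assoc_poly_def m
      by (simp add: poly_monom power_mult power2_eq_square algebra_simps)
    finally show "poly (R * ([:- 1, 1:] * [:1, 1:])) z = poly (assoc_poly n b0 b1 cm1 c0) z" .
  qed
  have "reduced_poly n b0 b1 cm1 c0 * ([:- 1, 1:] * [:1, 1:]) = R * ([:- 1, 1:] * [:1, 1:])"
    by (simp only: R reduced_poly_mult)
  \<comment> \<open>Cancellation of polynomials covers the points \<open>y = 1\<close> and \<open>y = - 1\<close>, where division by $y^2 - 1$ would fail.\<close>
  then have red: "reduced_poly n b0 b1 cm1 c0 = R"
    by (subst (asm) mult_cancel_right) auto
  have s: "y ^ k * rec_sol x k = y * poly (g k) y" for k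
    unfolding x_def poly_g by (rule rec_sol_geometric[OF y])
  have e: "y ^ m * end_form cm1 c0 x m =
      poly (g (m + 1) + [:0, c0:] * g m + [:0, 0, cm1:] * g (m - 1)) y" if "m \<ge> 1" for m
  proof -
    obtain j where j: "m = Suc j" using \<open>m \<ge> 1\<close> by (cases m) auto
    have "y * (y ^ m * end_form cm1 c0 x m) =
      y ^ (m + 1) * rec_sol x (m + 1) + c0 * y * (y ^ m * rec_sol x m)
        + cm1 * y\<^sup>2 * (y ^ (m - 1) * rec_sol x (m - 1))"
      unfolding end_form_def j by (simp add: algebra_simps power2_eq_square)
    also have "\<dots> = y * poly (g (m + 1) + [:0, c0:] * g m + [:0, 0, cm1:] * g (m - 1)) y"
      unfolding s by (simp add: algebra_simps power2_eq_square)
    finally show ?thesis using y by simp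
  qed
  have "y ^ (n + 1) *
      ((b0 + b1 * x) * end_form cm1 c0 x n + (1 - b1) * end_form cm1 c0 x (Suc n))
    = (y * (b0 + b1 * x)) * (y ^ n * end_form cm1 c0 x n)
      + (1 - b1) * (y ^ Suc n * end_form cm1 c0 x (Suc n))"
    by (simp add: algebra_simps)
  also have "y * (b0 + b1 * x) = poly [:b1, b0, b1:] y"
    unfolding x_def using y by (simp add: field_simps)
  also have "poly [:b1, b0, b1:] y * (y ^ n * end_form cm1 c0 x n)
      + (1 - b1) * (y ^ Suc n * end_form cm1 c0 x (Suc n)) = poly R y"
    unfolding R_def e[OF n] e[OF le_SucI[OF n]] by (simp add: algebra_simps)
  finally show ?thesis unfolding red by simp
qed

text \<open>The equation for \<open>y\<close> is the quadratic $y^2 - x y + 1 = 0$, whose roots are nonzero.\<close>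

lemma ex_add_inverse_eq:
  fixes x :: complex
  shows "\<exists>y. y \<noteq> 0 \<and> x = y + inverse y"
proof -
  define d where "d = csqrt (x\<^sup>2 - 4)"
  define y where "y = (x + d) / 2"
  have "d\<^sup>2 = x\<^sup>2 - 4" by (simp add: d_def)
  then have prod: "y * (x - y) = 1"
    unfolding y_def by (simp add: field_simps power2_eq_square)
  then have "inverse y = x - y" by (rule inverse_unique)
  with prod show ?thesis by (intro exI[of _ y]) auto
qed

theorem proposition2p2:
  fixes n :: nat and b0 b1 cm1 c0 :: complex and T :: "complex set"
  assumes "n \<ge> 1"
    and "T = {y. poly (reduced_poly n b0 b1 cm1 c0) y = 0}"
  shows "spectrum (tridiag_mat n b0 b1 cm1 c0) = {y + inverse y | y. y \<in> T}"
proof -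
  have T_iff: "y \<in> T \<longleftrightarrow> y + inverse y \<in> spectrum (tridiag_mat n b0 b1 cm1 c0)"
    if "y \<noteq> 0" for y
    using that assms
    by (simp add: spectrum_def eigenvalue_tridiag_iff poly_reduced_poly_eq del: mult_cancel_left)
  have "0 \<notin> T"
    using reduced_poly_0_nonzero[OF assms(1)] assms(2) by simp
  show ?thesis
  proof (intro equalityI subsetI)
    fix x assume "x \<in> spectrum (tridiag_mat n b0 b1 cm1 c0)"
    moreover obtain y where "y \<noteq> 0" "x = y + inverse y"
      using ex_add_inverse_eq by blast
    ultimately show "x \<in> {y + inverse y | y. y \<in> T}"
      using T_iff by blast
  next
    fix x assume "x \<in> {y + inverse y | y. y \<in> T}"
    then obtain y where "y \<in> T" "x = y + inverse y" by blast
    moreover from this \<open>0 \<notin> T\<close> have "y \<noteq> 0" by metis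
    ultimately show "x \<in> spectrum (tridiag_mat n b0 b1 cm1 c0)"
      using T_iff by blast
  qed
qed

end
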